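(* Let $M$ be a countable $\omega$-categorical homogeneous structure with weak elimination of imaginaries and no algebraicity. Then $$\mathrm{Aut}_{\mathrm{top}}(\mathrm{Aut}(M))\cong \mathrm{Aut}(\mathcal{E}_M),$$ where $\mathcal{E}_M$ is the orbital structure associated with $M$. In particular, if $M$ has in addition the small index property, then $\mathrm{Aut}(\mathrm{Aut}(M))\cong\mathrm{Aut}(\mathcal{E}_M)$.
   Context: A countable structure is $\omega$-categorical if it is, up to isomorphism, the only countable model of its first-order theory. $G=\mathrm{Aut}(M)$ carries the topology whose basic open subgroups are the pointwise stabilizers of finite subsets of $M$; $\mathrm{Aut}_{\mathrm{top}}(G)$ is the group of group automorphisms of $G$ that are homeomorphisms, and $\mathrm{Aut}(G)$ is the group of all group automorphisms. $M$ is homogeneous if every isomorphism between finitely generated substructures extends to an automorphism of $M$. For $A\subseteq M$, $G_{(A)}$ and $G_{\{A\}}$ are the pointwise and setwise stabilizers of $A$. For finite $A$, $a\in M$ is algebraic over $A$ if its $G_{(A)}$-orbit is finite; a finite set is algebraically closed if it contains all elements algebraic over it; $M$ has no algebraicity if every finite subset of $M$ is algebraically closed. $M$ has weak elimination of imaginaries if for every $H\leq G$ containing the pointwise stabilizer of a finite set there is a unique smallest finite algebraically closed $K\subseteq M$ with $G_{(K)}\leq H\leq G_{\{K\}}$. $M$ has the small index property if every subgroup of $G$ of index less than $2^{\aleph_0}$ is open. The orbital structure $\mathcal{E}_M$ has the same domain as $M$ and, for every $0<n<\omega$, a relation $E_n$ of arity $2n$ such that, for $\bar a,\bar b\in M^n$,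 $\bar a E_n\bar b$ iff there is an automorphism of $M$ mapping $\bar a$ to $\bar b$. *)

theory Defs
  imports
    "HOL-Algebra.Bij"
    "HOL-Algebra.Coset"
    "HOL-Analysis.Abstract_Topology"
    "HOL-Library.Countable_Set"
    "HOL-Library.Equipollence"
begin

section \<open>First-order structures\<close>

text \<open>
  A language is given by \<^emph>\<open>sets\<close> of function and relation symbols, since HOL types are
  never empty and purely relational languages must be allowed. Constants are function symbols of
  arity 0. Interpretations are only relevant for symbols of the language and for tuples
  of the right length with entries in the universe.
\<close>

record ('f, 'r) language =
  funs :: "'f set"
  rels :: "'r set"
  farity :: "'f \<Rightarrow> nat"
  rarity :: "'r \<Rightarrow> nat"

record ('a, 'f, 'r) fo_structure =
  univ :: "'a set"
  fint :: "'f \<Rightarrow> 'a list \<Rightarrow> 'a"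
  rint :: "'r \<Rightarrow> 'a list \<Rightarrow> bool"

definition tuples :: "'a set \<Rightarrow> nat \<Rightarrow> 'a list set" where
  "tuples A n = {xs. length xs = n \<and> set xs \<subseteq> A}"

definition closed_under_funs ::
    "('f, 'r) language \<Rightarrow> ('a, 'f, 'r) fo_structure \<Rightarrow> 'a set \<Rightarrow> bool" where
  "closed_under_funs L M S \<longleftrightarrow> (\<forall>f\<in>funs L. \<forall>xs\<in>tuples S (farity L f). fint M f xs \<in> S)"

definition is_structure :: "('f, 'r) language \<Rightarrow> ('a, 'f, 'r) fo_structure \<Rightarrow> bool" where
  "is_structure L M \<longleftrightarrow> univ M \<noteq> {} \<and> closed_under_funs L M (univ M)"

definition struct_iso ::
    "('f, 'r) language \<Rightarrow> ('a, 'f, 'r) fo_structure \<Rightarrow> ('b, 'f, 'r) fo_structure \<Rightarrow> ('a \<Rightarrow> 'b) \<Rightarrow> bool"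
  where
  "struct_iso L M N h \<longleftrightarrow>
     bij_betw h (univ M) (univ N) \<and>
     (\<forall>f\<in>funs L. \<forall>xs\<in>tuples (univ M) (farity L f). h (fint M f xs) = fint N f (map h xs)) \<and>
     (\<forall>r\<in>rels L. \<forall>xs\<in>tuples (univ M) (rarity L r). rint M r xs \<longleftrightarrow> rint N r (map h xs))"


section \<open>Formulas and \<open>\<omega>\<close>-categoricity\<close>

datatype 'f trm = Var nat | Fn 'f "'f trm list"

datatype ('f, 'r) formula =
    Bot
  | Eql "'f trm" "'f trm"
  | Rl 'r "'f trm list"
  | Imp "('f, 'r) formula" "('f, 'r) formula"
  | All nat "('f, 'r) formula"

fun trm_in :: "('f, 'r) language \<Rightarrow> 'f trm \<Rightarrow> bool" where
  "trm_in L (Var i) \<longleftrightarrow> True"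
| "trm_in L (Fn f ts) \<longleftrightarrow> f \<in> funs L \<and> length ts = farity L f \<and> (\<forall>t\<in>set ts. trm_in L t)"

fun formula_in :: "('f, 'r) language \<Rightarrow> ('f, 'r) formula \<Rightarrow> bool" where
  "formula_in L Bot \<longleftrightarrow> True"
| "formula_in L (Eql s t) \<longleftrightarrow> trm_in L s \<and> trm_in L t"
| "formula_in L (Rl r ts) \<longleftrightarrow> r \<in> rels L \<and> length ts = rarity L r \<and> (\<forall>t\<in>set ts. trm_in L t)"
| "formula_in L (Imp p q) \<longleftrightarrow> formula_in L p \<and> formula_in L q"
| "formula_in L (All i p) \<longleftrightarrow> formula_in L p"

fun trm_vars :: "'f trm \<Rightarrow> nat set" where
  "trm_vars (Var i) = {i}"
| "trm_vars (Fn f ts) = (\<Union>t\<in>set ts. trm_vars t)"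

fun free_vars :: "('f, 'r) formula \<Rightarrow> nat set" where
  "free_vars Bot = {}"
| "free_vars (Eql s t) = trm_vars s \<union> trm_vars t"
| "free_vars (Rl r ts) = (\<Union>t\<in>set ts. trm_vars t)"
| "free_vars (Imp p q) = free_vars p \<union> free_vars q"
| "free_vars (All i p) = free_vars p - {i}"

fun trm_val :: "('a, 'f, 'r) fo_structure \<Rightarrow> (nat \<Rightarrow> 'a) \<Rightarrow> 'f trm \<Rightarrow> 'a" where
  "trm_val M v (Var i) = v i"
| "trm_val M v (Fn f ts) = fint M f (map (trm_val M v) ts)"

fun sat :: "('a, 'f, 'r) fo_structure \<Rightarrow> (nat \<Rightarrow> 'a) \<Rightarrow> ('f, 'r) formula \<Rightarrow> bool" where
  "sat M v Bot \<longleftrightarrow> False"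
| "sat M v (Eql s t) \<longleftrightarrow> trm_val M v s = trm_val M v t"
| "sat M v (Rl r ts) \<longleftrightarrow> rint M r (map (trm_val M v) ts)"
| "sat M v (Imp p q) \<longleftrightarrow> (sat M v p \<longrightarrow> sat M v q)"
| "sat M v (All i p) \<longleftrightarrow> (\<forall>a\<in>univ M. sat M (v(i := a)) p)"

definition sentences :: "('f, 'r) language \<Rightarrow> ('f, 'r) formula set" where
  "sentences L = {p. formula_in L p \<and> free_vars p = {}}"

definition models :: "('a, 'f, 'r) fo_structure \<Rightarrow> ('f, 'r) formula \<Rightarrow> bool" where
  "models M p \<longleftrightarrow> (\<forall>v. range v \<subseteq> univ M \<longrightarrow> sat M v p)"

definition theory_of :: "('f, 'r) language \<Rightarrow> ('a, 'f, 'r) fo_structure \<Rightarrow> ('f, 'r) formula set" where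
  "theory_of L M = {p \<in> sentences L. models M p}"

text \<open>
  The competing models have their universe in \<^typ>\<open>nat\<close>; every countable structure has an
  isomorphic copy of this form, so nothing is lost. The language may be of any cardinality.
\<close>

definition omega_categorical :: "('f, 'r) language \<Rightarrow> ('a, 'f, 'r) fo_structure \<Rightarrow> bool" where
  "omega_categorical L M \<longleftrightarrow>
     countable (univ M) \<and>
     (\<forall>N :: (nat, 'f, 'r) fo_structure.
        is_structure L N \<longrightarrow> (\<forall>p\<in>theory_of L M. models N p) \<longrightarrow> (\<exists>h. struct_iso L M N h))"


section \<open>The automorphism group and its topology\<close>

text \<open>
  Following \<^const>\<open>Bij\<close>, automorphisms are taken to be extensional functions, i.e. they are
  \<^const>\<open>undefined\<close> outside the universe, so that two automorphisms are equal iff they agree on it.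
\<close>

definition Aut :: "('f, 'r) language \<Rightarrow> ('a, 'f, 'r) fo_structure \<Rightarrow> ('a \<Rightarrow> 'a) set" where
  "Aut L M = {g \<in> Bij (univ M). struct_iso L M M g}"

definition AutGrp :: "('f, 'r) language \<Rightarrow> ('a, 'f, 'r) fo_structure \<Rightarrow> ('a \<Rightarrow> 'a) monoid" where
  "AutGrp L M = BijGroup (univ M) \<lparr>carrier := Aut L M\<rparr>"

definition pw_stab ::
    "('f, 'r) language \<Rightarrow> ('a, 'f, 'r) fo_structure \<Rightarrow> 'a set \<Rightarrow> ('a \<Rightarrow> 'a) set" where
  "pw_stab L M A = {g \<in> Aut L M. \<forall>a\<in>A. g a = a}"

definition set_stab ::
    "('f, 'r) language \<Rightarrow> ('a, 'f, 'r) fo_structure \<Rightarrow> 'a set \<Rightarrow> ('a \<Rightarrow> 'a) set" where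
  "set_stab L M A = {g \<in> Aut L M. g ` A = A}"

definition aut_topology ::
    "('f, 'r) language \<Rightarrow> ('a, 'f, 'r) fo_structure \<Rightarrow> ('a \<Rightarrow> 'a) topology" where
  "aut_topology L M = topology_generated_by
     {g <#\<^bsub>AutGrp L M\<^esub> pw_stab L M A | g A. g \<in> Aut L M \<and> finite A \<and> A \<subseteq> univ M}"

text \<open>
  The library's \<^const>\<open>AutoGroup\<close> is the group of all automorphisms of an abstract group; the
  following is its subgroup of automorphisms that are homeomorphisms.
\<close>

definition TopAutoGroup :: "('g, 'm) monoid_scheme \<Rightarrow> 'g topology \<Rightarrow> ('g \<Rightarrow> 'g) monoid" where
  "TopAutoGroup G T = AutoGroup G \<lparr>carrier := {\<phi> \<in> auto G. homeomorphic_map T T \<phi>}\<rparr>"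


section \<open>Properties of structures\<close>

inductive_set generated ::
    "('f, 'r) language \<Rightarrow> ('a, 'f, 'r) fo_structure \<Rightarrow> 'a set \<Rightarrow> 'a set"
  for L M A where
  base: "a \<in> A \<Longrightarrow> a \<in> generated L M A"
| app: "f \<in> funs L \<Longrightarrow> length xs = farity L f \<Longrightarrow> (\<forall>x\<in>set xs. x \<in> generated L M A) \<Longrightarrow>
     fint M f xs \<in> generated L M A"

definition homogeneous :: "('f, 'r) language \<Rightarrow> ('a, 'f, 'r) fo_structure \<Rightarrow> bool" where
  "homogeneous L M \<longleftrightarrow>
     (\<forall>A B h. finite A \<and> A \<subseteq> univ M \<and> finite B \<and> B \<subseteq> univ M \<and>
        struct_iso L (M\<lparr>univ := generated L M A\<rparr>) (M\<lparr>univ := generated L M B\<rparr>) h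
      \<longrightarrow> (\<exists>g\<in>Aut L M. \<forall>x\<in>generated L M A. g x = h x))"

definition algebraic_over ::
    "('f, 'r) language \<Rightarrow> ('a, 'f, 'r) fo_structure \<Rightarrow> 'a set \<Rightarrow> 'a \<Rightarrow> bool" where
  "algebraic_over L M A a \<longleftrightarrow> a \<in> univ M \<and> finite {g a | g. g \<in> pw_stab L M A}"

definition alg_closed :: "('f, 'r) language \<Rightarrow> ('a, 'f, 'r) fo_structure \<Rightarrow> 'a set \<Rightarrow> bool" where
  "alg_closed L M A \<longleftrightarrow> (\<forall>a. algebraic_over L M A a \<longrightarrow> a \<in> A)"

definition no_algebraicity :: "('f, 'r) language \<Rightarrow> ('a, 'f, 'r) fo_structure \<Rightarrow> bool" where
  "no_algebraicity L M \<longleftrightarrow> (\<forall>A. finite A \<and> A \<subseteq> univ M \<longrightarrow> alg_closed L M A)"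

definition wei_support ::
    "('f, 'r) language \<Rightarrow> ('a, 'f, 'r) fo_structure \<Rightarrow> ('a \<Rightarrow> 'a) set \<Rightarrow> 'a set \<Rightarrow> bool" where
  "wei_support L M H K \<longleftrightarrow>
     finite K \<and> K \<subseteq> univ M \<and> alg_closed L M K \<and> pw_stab L M K \<subseteq> H \<and> H \<subseteq> set_stab L M K"

definition weak_elim_imaginaries :: "('f, 'r) language \<Rightarrow> ('a, 'f, 'r) fo_structure \<Rightarrow> bool" where
  "weak_elim_imaginaries L M \<longleftrightarrow>
     (\<forall>H. subgroup H (AutGrp L M) \<and> (\<exists>A. finite A \<and> A \<subseteq> univ M \<and> pw_stab L M A \<subseteq> H)
      \<longrightarrow> (\<exists>!K. wei_support L M H K \<and> (\<forall>K'. wei_support L M H K' \<longrightarrow> K \<subseteq> K')))"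

definition small_index_property :: "('f, 'r) language \<Rightarrow> ('a, 'f, 'r) fo_structure \<Rightarrow> bool" where
  "small_index_property L M \<longleftrightarrow>
     (\<forall>H. subgroup H (AutGrp L M) \<and> rcosets\<^bsub>AutGrp L M\<^esub> H \<prec> (UNIV :: nat set set)
      \<longrightarrow> openin (aut_topology L M) H)"


section \<open>The orbital structure\<close>

text \<open>
  The relation symbol \<open>n > 0\<close> stands for \<open>E\<^sub>n\<close>; a \<open>2n\<close>-tuple is read as a pair of
  \<open>n\<close>-tuples. There are no function symbols, so the \<^typ>\<open>unit\<close>-indexed \<^const>\<open>fint\<close> is irrelevant.
\<close>

definition orbital_language :: "(unit, nat) language" where
  "orbital_language = \<lparr>funs = {}, rels = {0<..}, farity = (\<lambda>_. 0), rarity = (\<lambda>n. 2 * n)\<rparr>"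

definition orbital_structure ::
    "('f, 'r) language \<Rightarrow> ('a, 'f, 'r) fo_structure \<Rightarrow> ('a, unit, nat) fo_structure" where
  "orbital_structure L M = \<lparr>univ = univ M, fint = (\<lambda>_ _. undefined),
     rint = (\<lambda>n xs. \<exists>g\<in>Aut L M. map g (take n xs) = drop n xs)\<rparr>"

end

theory Submission
  imports Defs
begin

text \<open>
  The isomorphism sends \<open>h \<in> Aut \<E>\<^sub>M\<close> to conjugation by \<open>h\<close>, which maps \<open>Aut M\<close> to itself because
  \<open>Aut M\<close> contains every permutation that agrees locally with automorphisms. For surjectivity, weak
  elimination of imaginaries and the absence of algebraicity make the pointwise stabilizers of finite
  sets exactly the open subgroups without proper open subgroups of finite index. Hence a topological
  automorphism \<open>\<phi>\<close> permutes them, preserving inclusion, and therefore permutes the stabilizers of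
  points. The resulting permutation \<open>h\<close> of \<open>M\<close> satisfies \<open>\<phi> g (h a) = h (g a)\<close>, that is, \<open>\<phi>\<close> is
  conjugation by \<open>h\<close>. Under the small index property every endomorphism of \<open>Aut M\<close> is continuous,
  since the preimage of the stabilizer of a finite set has countable index.
\<close>

section \<open>Automorphism groups as permutation groups\<close>

lemma Bij_apply_closed: "f \<in> Bij S \<Longrightarrow> x \<in> S \<Longrightarrow> f x \<in> S"
  using Bij_imp_funcset by blast

lemma Bij_eqI: "f \<in> Bij S \<Longrightarrow> g \<in> Bij S \<Longrightarrow> (\<And>x. x \<in> S \<Longrightarrow> f x = g x) \<Longrightarrow> f = g"
  by (meson Bij_imp_extensional extensionalityI)

lemma Bij_apply_eq_iff: "f \<in> Bij S \<Longrightarrow> x \<in> S \<Longrightarrow> y \<in> S \<Longrightarrow> f x = f y \<longleftrightarrow> x = y"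
  by (auto simp: Bij_def bij_betw_def inj_on_def)

lemma carrier_BijGroup [simp]: "carrier (BijGroup S) = Bij S"
  by (simp add: BijGroup_def)

lemma BijGroup_mult_eq_compose:
  "f \<in> Bij S \<Longrightarrow> g \<in> Bij S \<Longrightarrow> f \<otimes>\<^bsub>BijGroup S\<^esub> g = compose S f g"
  by (simp add: BijGroup_def)

lemma BijGroup_mult_apply:
  "f \<in> Bij S \<Longrightarrow> g \<in> Bij S \<Longrightarrow> x \<in> S \<Longrightarrow> (f \<otimes>\<^bsub>BijGroup S\<^esub> g) x = f (g x)"
  by (simp add: BijGroup_def compose_def)

lemma BijGroup_one_apply: "x \<in> S \<Longrightarrow> \<one>\<^bsub>BijGroup S\<^esub> x = x"
  by (simp add: BijGroup_def)

lemma BijGroup_mult_closed: "f \<in> Bij S \<Longrightarrow> g \<in> Bij S \<Longrightarrow> f \<otimes>\<^bsub>BijGroup S\<^esub> g \<in> Bij S"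
  by (metis carrier_BijGroup group.is_monoid group_BijGroup monoid.m_closed)

lemma BijGroup_inv_closed: "f \<in> Bij S \<Longrightarrow> inv\<^bsub>BijGroup S\<^esub> f \<in> Bij S"
  by (metis carrier_BijGroup group.inv_closed group_BijGroup)

lemma BijGroup_inv_apply:
  assumes "f \<in> Bij S" "x \<in> S"
  shows "(inv\<^bsub>BijGroup S\<^esub> f) (f x) = x" "f ((inv\<^bsub>BijGroup S\<^esub> f) x) = x"
  using assms bij_betw_inv_into_left[of f S S] bij_betw_inv_into_right[of f S S]
  by (simp_all add: inv_BijGroup Bij_apply_closed) (simp_all add: Bij_def)

lemmas Bij_simps = BijGroup_mult_apply BijGroup_one_apply BijGroup_inv_apply
  BijGroup_mult_closed BijGroup_inv_closed Bij_apply_closed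

lemma carrier_AutGrp [simp]: "carrier (AutGrp L M) = Aut L M"
  and mult_AutGrp [simp]: "mult (AutGrp L M) = mult (BijGroup (univ M))"
  and one_AutGrp [simp]: "one (AutGrp L M) = one (BijGroup (univ M))"
  by (simp_all add: AutGrp_def)

lemma Aut_Bij: "g \<in> Aut L M \<Longrightarrow> g \<in> Bij (univ M)"
  by (simp add: Aut_def)

lemma Aut_fint:
  assumes "g \<in> Aut L M" "f \<in> funs L" "length xs = farity L f" "set xs \<subseteq> univ M"
  shows "g (fint M f xs) = fint M f (map g xs)"
  using assms by (auto simp: Aut_def struct_iso_def tuples_def)

lemma Aut_rint:
  assumes "g \<in> Aut L M" "r \<in> rels L" "length xs = rarity L r" "set xs \<subseteq> univ M"
  shows "rint M r (map g xs) \<longleftrightarrow> rint M r xs"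
  using assms by (auto simp: Aut_def struct_iso_def tuples_def)

lemma AutI:
  assumes "g \<in> Bij (univ M)"
    and "\<And>f xs. f \<in> funs L \<Longrightarrow> length xs = farity L f \<Longrightarrow> set xs \<subseteq> univ M \<Longrightarrow>
       g (fint M f xs) = fint M f (map g xs)"
    and "\<And>r xs. r \<in> rels L \<Longrightarrow> length xs = rarity L r \<Longrightarrow> set xs \<subseteq> univ M \<Longrightarrow>
       rint M r xs \<longleftrightarrow> rint M r (map g xs)"
  shows "g \<in> Aut L M"
  using assms by (auto simp: Aut_def struct_iso_def tuples_def Bij_def)

lemma fint_in_univ:
  assumes "is_structure L M" "f \<in> funs L" "length xs = farity L f" "set xs \<subseteq> univ M"
  shows "fint M f xs \<in> univ M"
  using assms by (auto simp: is_structure_def closed_under_funs_def tuples_def)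

lemma Aut_subgroup:
  assumes "is_structure L M"
  shows "subgroup (Aut L M) (BijGroup (univ M))"
proof (rule subgroup.intro)
  show "Aut L M \<subseteq> carrier (BijGroup (univ M))"
    by (auto simp: Aut_def)
next
  fix g h assume gh: "g \<in> Aut L M" "h \<in> Aut L M"
  then have B: "g \<in> Bij (univ M)" "h \<in> Bij (univ M)" by (simp_all add: Aut_Bij)
  have m: "map (g \<otimes>\<^bsub>BijGroup (univ M)\<^esub> h) xs = map g (map h xs)" "set (map h xs) \<subseteq> univ M"
    if "set xs \<subseteq> univ M" for xs
    using that B by (auto simp: Bij_simps subset_iff)
  show "g \<otimes>\<^bsub>BijGroup (univ M)\<^esub> h \<in> Aut L M"
  proof (rule AutI)
    fix f xs assume f: "f \<in> funs L" "length xs = farity L f" "set xs \<subseteq> univ M"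
    have "(g \<otimes>\<^bsub>BijGroup (univ M)\<^esub> h) (fint M f xs) = g (h (fint M f xs))"
      using fint_in_univ[OF assms f] B by (simp add: Bij_simps)
    also have "\<dots> = fint M f (map g (map h xs))"
      using Aut_fint[OF gh(2) f] Aut_fint[OF gh(1), of f "map h xs"] f m(2)[OF f(3)] by simp
    finally show "(g \<otimes>\<^bsub>BijGroup (univ M)\<^esub> h) (fint M f xs)
        = fint M f (map (g \<otimes>\<^bsub>BijGroup (univ M)\<^esub> h) xs)"
      by (simp only: m(1)[OF f(3)])
  next
    fix r xs assume r: "r \<in> rels L" "length xs = rarity L r" "set xs \<subseteq> univ M"
    then show "rint M r xs \<longleftrightarrow> rint M r (map (g \<otimes>\<^bsub>BijGroup (univ M)\<^esub> h) xs)"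
      using Aut_rint[OF gh(2) r] Aut_rint[OF gh(1), of r "map h xs"] m(2)[OF r(3)]
      by (simp only: m(1)[OF r(3)] length_map)
  qed (use B in \<open>simp add: Bij_simps\<close>)
next
  have m: "map (\<one>\<^bsub>BijGroup (univ M)\<^esub>) xs = xs" if "set xs \<subseteq> univ M" for xs
    using that by (simp add: BijGroup_one_apply map_idI subset_iff)
  show "\<one>\<^bsub>BijGroup (univ M)\<^esub> \<in> Aut L M"
    by (rule AutI) (simp_all add: m fint_in_univ[OF assms] BijGroup_one_apply, simp add: BijGroup_def id_Bij)
next
  fix g assume g: "g \<in> Aut L M"
  then have B: "g \<in> Bij (univ M)" by (simp add: Aut_Bij)
  let ?i = "inv\<^bsub>BijGroup (univ M)\<^esub> g"
  have m: "map g (map ?i xs) = xs" "set (map ?i xs) \<subseteq> univ M" if "set xs \<subseteq> univ M" for xs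
  proof -
    show "map g (map ?i xs) = xs"
      unfolding map_map using that B by (intro map_idI) (auto simp: subset_iff Bij_simps)
    show "set (map ?i xs) \<subseteq> univ M"
      using that B by (auto simp: subset_iff Bij_simps)
  qed
  show "?i \<in> Aut L M"
  proof (rule AutI)
    fix f xs assume f: "f \<in> funs L" "length xs = farity L f" "set xs \<subseteq> univ M"
    have "g (fint M f (map ?i xs)) = fint M f xs"
      using Aut_fint[OF g f(1), of "map ?i xs"] f(2) m[OF f(3)] by simp
    then show "?i (fint M f xs) = fint M f (map ?i xs)"
      using BijGroup_inv_apply(1)[OF B] fint_in_univ[OF assms f(1), of "map ?i xs"] f(2) m(2)[OF f(3)]
      by (metis length_map)
  next
    fix r xs assume r: "r \<in> rels L" "length xs = rarity L r" "set xs \<subseteq> univ M"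
    then show "rint M r xs \<longleftrightarrow> rint M r (map ?i xs)"
      using Aut_rint[OF g r(1), of "map ?i xs"] m[OF r(3)] by simp
  qed (use B in \<open>simp add: Bij_simps\<close>)
qed

lemma group_AutGrp: "is_structure L M \<Longrightarrow> group (AutGrp L M)"
  unfolding AutGrp_def by (rule subgroup.subgroup_is_group[OF Aut_subgroup group_BijGroup])

text \<open>Each condition defining an automorphism involves only finitely many elements, so it can
  be checked on a \<open>g\<close> that agrees with \<open>k\<close> there; for a function symbol
  the value is added to the tuple. In other words, \<open>Aut L M\<close> is closed in the symmetric
  group.\<close>

lemma Aut_mem_if_locally_Aut:
  assumes "is_structure L M" and k: "k \<in> Bij (univ M)"
    and loc: "\<And>xs. set xs \<subseteq> univ M \<Longrightarrow> \<exists>g\<in>Aut L M. map g xs = map k xs"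
  shows "k \<in> Aut L M"
proof (rule AutI[OF k])
  fix f xs assume f: "f \<in> funs L" "length xs = farity L f" "set xs \<subseteq> univ M"
  obtain g where "g \<in> Aut L M" "map g (fint M f xs # xs) = map k (fint M f xs # xs)"
    using loc[of "fint M f xs # xs"] fint_in_univ[OF assms(1) f] f(3) by auto
  then show "k (fint M f xs) = fint M f (map k xs)"
    using Aut_fint[OF _ f, of g] by (metis list.inject list.map(2))
next
  fix r xs assume r: "r \<in> rels L" "length xs = rarity L r" "set xs \<subseteq> univ M"
  then show "rint M r xs \<longleftrightarrow> rint M r (map k xs)"
    using loc[OF r(3)] Aut_rint[OF _ r] by metis
qed

text \<open>Choosing a representative in each fibre of \<open>t\<close> defines \<open>f\<close>. It
  serves for counting: \<open>c\<close> takes no more values on \<open>S\<close> than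
  \<open>t\<close> does, so finiteness or countability passes from \<open>t\<close>
  S\<open>to\<close>c \<open>S\<close>.\<close>

lemma factors_through:
  assumes "\<And>x y. x \<in> S \<Longrightarrow> y \<in> S \<Longrightarrow> t x = t y \<Longrightarrow> c x = c y"
  obtains f where "c ` S = f ` (t ` S)"
proof
  show "c ` S = (\<lambda>z. c (SOME x. x \<in> S \<and> t x = z)) ` (t ` S)"
    unfolding image_image
  proof (rule image_cong)
    fix x assume "x \<in> S"
    then have "(SOME y. y \<in> S \<and> t y = t x) \<in> S \<and> t (SOME y. y \<in> S \<and> t y = t x) = t x"
      by (intro someI[of "\<lambda>y. y \<in> S \<and> t y = t x" x]) simp
    then show "c x = c (SOME y. y \<in> S \<and> t y = t x)"
      using assms \<open>x \<in> S\<close> by metis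
  qed simp
qed

lemma univ_orbital_structure [simp]: "univ (orbital_structure L M) = univ M"
  by (simp add: orbital_structure_def)

section \<open>The automorphism group of a fixed structure\<close>

locale structure_automorphisms =
  fixes L :: "('f, 'r) language" and M :: "('a, 'f, 'r) fo_structure"
  assumes str: "is_structure L M"
begin

abbreviation U where "U \<equiv> univ M"
abbreviation G where "G \<equiv> Aut L M"
abbreviation S where "S \<equiv> pw_stab L M"
abbreviation bmult (infixl "\<bullet>" 70) where "g \<bullet> h \<equiv> g \<otimes>\<^bsub>BijGroup U\<^esub> h"
abbreviation binv where "binv g \<equiv> inv\<^bsub>BijGroup U\<^esub> g"

sublocale B: group "BijGroup U"
  by (rule group_BijGroup)

sublocale A: group "AutGrp L M"
  by (rule group_AutGrp[OF str])

lemmas G_Bij = Aut_Bij[of _ L M]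

lemma G_closed [simp]:
  "g \<in> G \<Longrightarrow> h \<in> G \<Longrightarrow> g \<bullet> h \<in> G" "g \<in> G \<Longrightarrow> binv g \<in> G" "\<one>\<^bsub>BijGroup U\<^esub> \<in> G"
  using Aut_subgroup[OF str]
  by (auto simp: subgroup.m_closed subgroup.m_inv_closed subgroup.one_closed)

lemma G_apply [simp]:
  assumes "g \<in> G" "x \<in> U"
  shows "g x \<in> U" "h \<in> G \<Longrightarrow> (h \<bullet> g) x = h (g x)" "binv g (g x) = x" "g (binv g x) = x"
  using assms by (simp_all add: Bij_simps G_Bij)

lemma inv_AutGrp: "g \<in> G \<Longrightarrow> inv\<^bsub>AutGrp L M\<^esub> g = binv g"
  unfolding AutGrp_def
  using group.m_inv_consistent[OF group_BijGroup Aut_subgroup[OF str]] by simp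

lemma hom_mult: "\<phi> \<in> hom (AutGrp L M) (AutGrp L M) \<Longrightarrow> g \<in> G \<Longrightarrow> h \<in> G \<Longrightarrow> \<phi> (g \<bullet> h) = \<phi> g \<bullet> \<phi> h"
  using hom_mult[of \<phi> "AutGrp L M" "AutGrp L M"] by simp

lemma hom_closed: "\<phi> \<in> hom (AutGrp L M) (AutGrp L M) \<Longrightarrow> g \<in> G \<Longrightarrow> \<phi> g \<in> G"
  using hom_in_carrier[of \<phi> "AutGrp L M" "AutGrp L M"] by simp

lemma hom_inv: "\<phi> \<in> hom (AutGrp L M) (AutGrp L M) \<Longrightarrow> g \<in> G \<Longrightarrow> \<phi> (binv g) = binv (\<phi> g)"
  using group_hom.hom_inv[of "AutGrp L M" "AutGrp L M" \<phi> g] hom_closed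
  by (simp add: group_hom_def group_hom_axioms_def A.is_group inv_AutGrp)

lemma pw_stab_subgroup: "A \<subseteq> U \<Longrightarrow> subgroup (S A) (AutGrp L M)"
proof (rule A.subgroupI)
  assume A: "A \<subseteq> U"
  show "S A \<subseteq> carrier (AutGrp L M)" by (auto simp: pw_stab_def)
  have "\<one>\<^bsub>BijGroup U\<^esub> \<in> S A"
    using A by (auto simp: pw_stab_def BijGroup_one_apply subset_iff)
  then show "S A \<noteq> {}" by blast
  fix g assume "g \<in> S A"
  then show "inv\<^bsub>AutGrp L M\<^esub> g \<in> S A"
    using A by (auto simp: pw_stab_def inv_AutGrp) (metis G_apply(3) subsetD)
next
  fix g h assume "A \<subseteq> U" "g \<in> S A" "h \<in> S A"
  then show "g \<otimes>\<^bsub>AutGrp L M\<^esub> h \<in> S A"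
    by (auto simp: pw_stab_def subset_iff)
qed

section \<open>Open subgroups and continuity\<close>

lemma mem_left_coset_iff:
  assumes "g \<in> G" "A \<subseteq> U"
  shows "k \<in> g <#\<^bsub>AutGrp L M\<^esub> S A \<longleftrightarrow> k \<in> G \<and> (\<forall>a\<in>A. k a = g a)"
proof
  assume "k \<in> g <#\<^bsub>AutGrp L M\<^esub> S A"
  then show "k \<in> G \<and> (\<forall>a\<in>A. k a = g a)"
    using assms by (auto simp: l_coset_def pw_stab_def subset_iff)
next
  assume k: "k \<in> G \<and> (\<forall>a\<in>A. k a = g a)"
  then have "binv g \<bullet> k \<in> S A"
    using assms by (auto simp: pw_stab_def subset_iff)
  moreover have "g \<bullet> (binv g \<bullet> k) = k"
    using k assms(1) by (intro Bij_eqI[of _ U]) (simp_all add: G_Bij)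
  ultimately show "k \<in> g <#\<^bsub>AutGrp L M\<^esub> S A"
    unfolding l_coset_def by force
qed

text \<open>This is the topology of pointwise convergence for discrete \<open>M\<close>. The
  generating cosets prescribe the values on a finite set, and in an intersection the two finite sets
  are united.\<close>

lemma openin_aut_topology_iff:
  "openin (aut_topology L M) V \<longleftrightarrow> V \<subseteq> G \<and>
     (\<forall>g\<in>V. \<exists>A. finite A \<and> A \<subseteq> U \<and> (\<forall>k\<in>G. (\<forall>a\<in>A. k a = g a) \<longrightarrow> k \<in> V))"
    (is "_ \<longleftrightarrow> ?R V")
proof
  assume "openin (aut_topology L M) V"
  then have "generate_topology_on
      {g <#\<^bsub>AutGrp L M\<^esub> S A | g A. g \<in> G \<and> finite A \<and> A \<subseteq> U} V"
    by (simp add: aut_topology_def openin_topology_generated_by_iff)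
  then show "?R V"
  proof induction
    case (Int V W)
    show ?case
    proof (intro conjI ballI)
      fix g assume g: "g \<in> V \<inter> W"
      obtain A where A: "finite A" "A \<subseteq> U" "\<forall>k\<in>G. (\<forall>a\<in>A. k a = g a) \<longrightarrow> k \<in> V"
        using Int.IH(1) g by blast
      obtain B where B: "finite B" "B \<subseteq> U" "\<forall>k\<in>G. (\<forall>a\<in>B. k a = g a) \<longrightarrow> k \<in> W"
        using Int.IH(2) g by blast
      show "\<exists>A. finite A \<and> A \<subseteq> U \<and> (\<forall>k\<in>G. (\<forall>a\<in>A. k a = g a) \<longrightarrow> k \<in> V \<inter> W)"
        using A B by (intro exI[of _ "A \<union> B"]) simp
    qed (use Int.IH in blast)
  next
    case (UN K)
    show ?case
    proof (intro conjI ballI)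
      fix g assume "g \<in> \<Union>K"
      then obtain V where V: "V \<in> K" "g \<in> V" by blast
      obtain A where "finite A" "A \<subseteq> U" "\<forall>k\<in>G. (\<forall>a\<in>A. k a = g a) \<longrightarrow> k \<in> V"
        using UN.IH[OF V(1)] V(2) by blast
      then show "\<exists>A. finite A \<and> A \<subseteq> U \<and> (\<forall>k\<in>G. (\<forall>a\<in>A. k a = g a) \<longrightarrow> k \<in> \<Union>K)"
        using V(1) by blast
    qed (use UN.IH in blast)
  next
    case (Basis V)
    then show ?case by (auto simp: mem_left_coset_iff)
  qed simp
next
  assume R: "?R V"
  show "openin (aut_topology L M) V"
    unfolding openin_subopen[of _ V]
  proof (intro ballI)
    fix g assume g: "g \<in> V"
    with R obtain A where A: "finite A" "A \<subseteq> U" "\<forall>k\<in>G. (\<forall>a\<in>A. k a = g a) \<longrightarrow> k \<in> V"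
      by blast
    moreover have "g \<in> G" using R g by blast
    moreover have "openin (aut_topology L M) (g <#\<^bsub>AutGrp L M\<^esub> S A)"
      unfolding aut_topology_def using A \<open>g \<in> G\<close> by (intro topology_generated_by_Basis) blast
    ultimately show "\<exists>T. openin (aut_topology L M) T \<and> g \<in> T \<and> T \<subseteq> V"
      by (intro exI[of _ "g <#\<^bsub>AutGrp L M\<^esub> S A"]) (auto simp: mem_left_coset_iff)
  qed
qed

lemma topspace_aut_topology [simp]: "topspace (aut_topology L M) = G"
proof -
  have "openin (aut_topology L M) G"
    by (auto simp: openin_aut_topology_iff)
  then show ?thesis
    using openin_aut_topology_iff[of "topspace (aut_topology L M)"]
      openin_subset[of "aut_topology L M" G] by auto
qed

lemma pw_stab_open: "finite A \<Longrightarrow> A \<subseteq> U \<Longrightarrow> openin (aut_topology L M) (S A)"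
  unfolding openin_aut_topology_iff by (auto simp: pw_stab_def)

lemma open_subgroup_contains_pw_stab:
  assumes "openin (aut_topology L M) H" "subgroup H (AutGrp L M)"
  shows "\<exists>A. finite A \<and> A \<subseteq> U \<and> S A \<subseteq> H"
proof -
  have "\<one>\<^bsub>BijGroup U\<^esub> \<in> H"
    using subgroup.one_closed[OF assms(2)] by simp
  then obtain A where "finite A" "A \<subseteq> U" "\<forall>k\<in>G. (\<forall>a\<in>A. k a = \<one>\<^bsub>BijGroup U\<^esub> a) \<longrightarrow> k \<in> H"
    using assms(1) unfolding openin_aut_topology_iff by blast
  then show ?thesis
    by (intro exI[of _ A]) (auto simp: pw_stab_def BijGroup_one_apply subset_iff)
qed

text \<open>For a homomorphism, continuity at the identity suffices: if \<open>k\<close> agrees with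
  \<open>g\<close> on \<open>B\<close>, then g^-1 k lies in \<open>S B\<close>, so its image fixes
  \<open>A\<close> pointwise and \<phi> k agrees with \<phi> g on \<open>A\<close>.\<close>

lemma hom_continuousI:
  assumes \<phi>: "\<phi> \<in> hom (AutGrp L M) (AutGrp L M)"
    and c: "\<And>A. finite A \<Longrightarrow> A \<subseteq> U \<Longrightarrow> \<exists>B. finite B \<and> B \<subseteq> U \<and> \<phi> ` S B \<subseteq> S A"
  shows "continuous_map (aut_topology L M) (aut_topology L M) \<phi>"
  unfolding continuous_map_def topspace_aut_topology
proof (intro conjI allI impI)
  show "\<phi> \<in> G \<rightarrow> G" using hom_closed[OF \<phi>] by blast
  fix V assume V: "openin (aut_topology L M) V"
  show "openin (aut_topology L M) {g \<in> G. \<phi> g \<in> V}"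
    unfolding openin_aut_topology_iff
  proof (intro conjI ballI)
    fix g assume g: "g \<in> {g \<in> G. \<phi> g \<in> V}"
    then obtain A where A: "finite A" "A \<subseteq> U" "\<forall>k\<in>G. (\<forall>a\<in>A. k a = \<phi> g a) \<longrightarrow> k \<in> V"
      using V unfolding openin_aut_topology_iff by blast
    obtain B where B: "finite B" "B \<subseteq> U" "\<phi> ` S B \<subseteq> S A"
      using c[OF A(1,2)] by blast
    have "\<phi> k \<in> V" if k: "k \<in> G" "\<forall>b\<in>B. k b = g b" for k
    proof -
      have "binv g \<bullet> k \<in> S B"
        using g k B(2) by (auto simp: pw_stab_def subset_iff)
      then have "\<phi> (binv g \<bullet> k) \<in> S A"
        using B(3) by blast
      moreover have "\<phi> (binv g \<bullet> k) = binv (\<phi> g) \<bullet> \<phi> k"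
        using g k by (simp add: hom_mult[OF \<phi>] hom_inv[OF \<phi>])
      ultimately have "\<forall>a\<in>A. binv (\<phi> g) (\<phi> k a) = a"
        using g k A(2) hom_closed[OF \<phi>] by (auto simp: pw_stab_def subset_iff)
      then have "\<forall>a\<in>A. \<phi> g (binv (\<phi> g) (\<phi> k a)) = \<phi> g a"
        by simp
      then have "\<forall>a\<in>A. \<phi> k a = \<phi> g a"
        using g k A(2) hom_closed[OF \<phi>] by (auto simp: subset_iff)
      then show ?thesis using A(3) hom_closed[OF \<phi> k(1)] by blast
    qed
    then show "\<exists>A. finite A \<and> A \<subseteq> U \<and> (\<forall>k\<in>G. (\<forall>a\<in>A. k a = g a) \<longrightarrow> k \<in> {g \<in> G. \<phi> g \<in> V})"
      using B by blast
  qed auto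
qed

lemma auto_inverse:
  assumes "\<phi> \<in> auto (AutGrp L M)"
  obtains \<psi> where "\<psi> \<in> auto (AutGrp L M)" "\<And>g. g \<in> G \<Longrightarrow> \<psi> (\<phi> g) = g" "\<And>g. g \<in> G \<Longrightarrow> \<phi> (\<psi> g) = g"
proof
  let ?i = "inv\<^bsub>BijGroup G\<^esub> \<phi>"
  have "\<phi> \<in> Bij G" using assms by (simp add: auto_def)
  then show "?i (\<phi> g) = g" "\<phi> (?i g) = g" if "g \<in> G" for g
    using that by (simp_all add: BijGroup_inv_apply)
  show "?i \<in> auto (AutGrp L M)"
    using subgroup.m_inv_closed[OF A.subgroup_auto assms] by simp
qed

text \<open>The inverse of \<phi> is again an automorphism of the group. Its continuity is asked of
  any right inverse \<psi>, so that users need not name the inverse.\<close>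

lemma homeomorphic_map_autoI:
  assumes "\<phi> \<in> auto (AutGrp L M)"
    and "\<And>\<psi>. \<psi> \<in> auto (AutGrp L M) \<Longrightarrow> (\<And>g. g \<in> G \<Longrightarrow> \<phi> (\<psi> g) = g) \<Longrightarrow> 
      continuous_map (aut_topology L M) (aut_topology L M) \<psi>"
    and "continuous_map (aut_topology L M) (aut_topology L M) \<phi>"
  shows "homeomorphic_map (aut_topology L M) (aut_topology L M) \<phi>"
proof -
  obtain \<psi> where "\<psi> \<in> auto (AutGrp L M)"
    "\<And>g. g \<in> G \<Longrightarrow> \<psi> (\<phi> g) = g" "\<And>g. g \<in> G \<Longrightarrow> \<phi> (\<psi> g) = g"
    using auto_inverse[OF assms(1)] by blast
  then have "homeomorphic_maps (aut_topology L M) (aut_topology L M) \<phi> \<psi>"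
    using assms(2,3) by (simp add: homeomorphic_maps_def)
  then show ?thesis by (rule homeomorphic_maps_imp_map)
qed

section \<open>Automatic continuity from the small index property\<close>

lemma pw_stab_preimage_subgroup:
  assumes \<phi>: "\<phi> \<in> hom (AutGrp L M) (AutGrp L M)" and A: "A \<subseteq> U"
  shows "subgroup {g \<in> G. \<phi> g \<in> S A} (AutGrp L M)"
proof (rule A.subgroupI)
  have "\<phi> \<one>\<^bsub>BijGroup U\<^esub> = \<one>\<^bsub>BijGroup U\<^esub>"
    using hom_one[OF \<phi> A.is_group A.is_group] by simp
  then have "\<one>\<^bsub>BijGroup U\<^esub> \<in> {g \<in> G. \<phi> g \<in> S A}"
    using subgroup.one_closed[OF pw_stab_subgroup[OF A]] by simp
  then show "{g \<in> G. \<phi> g \<in> S A} \<noteq> {}" by blast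
  fix g assume "g \<in> {g \<in> G. \<phi> g \<in> S A}"
  then show "inv\<^bsub>AutGrp L M\<^esub> g \<in> {g \<in> G. \<phi> g \<in> S A}"
    using subgroup.m_inv_closed[OF pw_stab_subgroup[OF A], of "\<phi> g"] hom_closed[OF \<phi>]
    by (auto simp: inv_AutGrp hom_inv[OF \<phi>])
next
  fix g h assume "g \<in> {g \<in> G. \<phi> g \<in> S A}" "h \<in> {g \<in> G. \<phi> g \<in> S A}"
  then show "g \<otimes>\<^bsub>AutGrp L M\<^esub> h \<in> {g \<in> G. \<phi> g \<in> S A}"
    using subgroup.m_closed[OF pw_stab_subgroup[OF A], of "\<phi> g" "\<phi> h"]
    by (auto simp: hom_mult[OF \<phi>])
qed auto

text \<open>The coset of \<open>g\<close> modulo the preimage of \<open>S A\<close> is determined by the restriction of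
  \<open>(\<phi> g)\<^sup>-\<^sup>1\<close> to \<open>A\<close>, so there are only countably many cosets.\<close>

lemma small_index_hom_continuous:
  assumes sip: "small_index_property L M" and cU: "countable U"
    and \<phi>: "\<phi> \<in> hom (AutGrp L M) (AutGrp L M)"
  shows "continuous_map (aut_topology L M) (aut_topology L M) \<phi>"
proof (rule hom_continuousI[OF \<phi>])
  fix A assume A: "finite A" "A \<subseteq> U"
  define H where "H = {g \<in> G. \<phi> g \<in> S A}"
  have clo: "\<phi> g \<in> G" if "g \<in> G" for g using hom_closed[OF \<phi> that] .
  have H: "subgroup H (AutGrp L M)"
    unfolding H_def by (rule pw_stab_preimage_subgroup[OF \<phi> A(2)])
  obtain as where as: "set as = A" using A(1) finite_list by blast
  \<comment> \<open>Inverses occur because the cosets are right cosets: \<open>g\<close> and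
    \<open>k\<close> give the same one iff g k^-1 lies in \<open>H\<close>, that is, iff the
    inverses of \<phi> g and \<phi> k agree on \<open>A\<close>. Listing \<open>A\<close> puts the
    values of \<open>t\<close> in the countable set \<open>lists U\<close>.\<close>
  define t where "t g = map (binv (\<phi> g)) as" for g
  have "H #>\<^bsub>AutGrp L M\<^esub> g = H #>\<^bsub>AutGrp L M\<^esub> k" if gk: "g \<in> G" "k \<in> G" "t g = t k" for g k
  proof -
    have eq: "binv (\<phi> g) a = binv (\<phi> k) a" if "a \<in> A" for a
      using gk(3) that as by (auto simp: t_def)
    have "(\<phi> g \<bullet> binv (\<phi> k)) a = a" if "a \<in> A" for a
    proof -
      have "a \<in> U" using that A(2) by blast
      then show ?thesis using eq[OF that] gk clo by (metis G_apply(2,4) G_closed(2))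
    qed
    then have "g \<bullet> binv k \<in> H"
      using gk clo by (auto simp: H_def pw_stab_def hom_mult[OF \<phi>] hom_inv[OF \<phi>])
    then have "g \<otimes>\<^bsub>AutGrp L M\<^esub> inv\<^bsub>AutGrp L M\<^esub> k \<in> H"
      using gk by (simp add: inv_AutGrp)
    then have "g \<in> H #>\<^bsub>AutGrp L M\<^esub> k"
      using gk subgroup.rcos_module_rev[OF H A.is_group] by simp
    then show ?thesis
      using gk A.repr_independence[OF _ _ H] by simp
  qed
  then obtain f where f: "(\<lambda>g. H #>\<^bsub>AutGrp L M\<^esub> g) ` G = f ` (t ` G)"
    using factors_through[of G t "\<lambda>g. H #>\<^bsub>AutGrp L M\<^esub> g"] by blast
  have "t ` G \<subseteq> lists U"
    using clo A(2) as by (auto simp: t_def subset_iff)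
  then have "countable (t ` G)"
    using cU countable_lists countable_subset by blast
  then have "countable (rcosets\<^bsub>AutGrp L M\<^esub> H)"
    using f by (simp add: RCOSETS_def UNION_singleton_eq_range)
  then have "rcosets\<^bsub>AutGrp L M\<^esub> H \<lesssim> (UNIV :: nat set)"
    unfolding lepoll_def by (auto elim: countableE)
  then have "rcosets\<^bsub>AutGrp L M\<^esub> H \<prec> (UNIV :: nat set set)"
    using lesspoll_trans1[OF _ lesspoll_Pow_self[of "UNIV :: nat set"]] by simp
  then have "openin (aut_topology L M) H"
    using sip H unfolding small_index_property_def by blast
  then show "\<exists>B. finite B \<and> B \<subseteq> U \<and> \<phi> ` S B \<subseteq> S A"
    using open_subgroup_contains_pw_stab[OF _ H] by (fastforce simp: H_def)
qed

section \<open>Conjugation by automorphisms of the orbital structure\<close>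

abbreviation Orb where "Orb \<equiv> Aut orbital_language (orbital_structure L M)"

text \<open>A 2n-tuple is split into its halves. There is no relation for n = 0, but for empty
  tuples both sides hold with the identity as witness.\<close>

lemma Orb_iff:
  "h \<in> Orb \<longleftrightarrow> h \<in> Bij U \<and>
    (\<forall>xs ys. length xs = length ys \<longrightarrow> set xs \<subseteq> U \<longrightarrow> set ys \<subseteq> U \<longrightarrow>
      ((\<exists>g\<in>G. map g xs = ys) \<longleftrightarrow> (\<exists>g\<in>G. map g (map h xs) = map h ys)))"
    (is "_ \<longleftrightarrow> _ \<and> (\<forall>xs ys. ?P xs ys)")
proof
  assume h: "h \<in> Orb"
  have "?P xs ys" for xs ys
  proof (cases "xs = []")
    case False
    show ?thesis
    proof (intro impI)
      assume xy: "length xs = length ys" "set xs \<subseteq> U" "set ys \<subseteq> U"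
      have "ys \<noteq> []" using xy(1) False by auto
      then show "(\<exists>g\<in>G. map g xs = ys) \<longleftrightarrow> (\<exists>g\<in>G. map g (map h xs) = map h ys)"
        using Aut_rint[OF h, of "length ys" "xs @ ys"] xy
        by (simp add: orbital_language_def orbital_structure_def)
    qed
  qed (use G_closed(3) in auto)
  then show "h \<in> Bij U \<and> (\<forall>xs ys. ?P xs ys)"
    using Aut_Bij[OF h] by simp
next
  assume h: "h \<in> Bij U \<and> (\<forall>xs ys. ?P xs ys)"
  show "h \<in> Orb"
  proof (rule AutI)
    fix n and xs :: "'a list"
    assume n: "n \<in> rels orbital_language" "length xs = rarity orbital_language n"
      "set xs \<subseteq> univ (orbital_structure L M)"
    then have "?P (take n xs) (drop n xs)"
      using h by blast
    moreover have "set (take n xs) \<subseteq> U" "set (drop n xs) \<subseteq> U"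
      using n(3) set_take_subset[of n xs] set_drop_subset[of n xs] by auto
    ultimately show "rint (orbital_structure L M) n xs
        \<longleftrightarrow> rint (orbital_structure L M) n (map h xs)"
      using n(2) by (simp add: orbital_language_def orbital_structure_def take_map drop_map)
  qed (use h in \<open>simp_all add: orbital_language_def\<close>)
qed

lemma is_structure_orbital: "is_structure orbital_language (orbital_structure L M)"
  using str by (simp add: is_structure_def closed_under_funs_def orbital_language_def)

lemma Orb_closed:
  "h \<in> Orb \<Longrightarrow> k \<in> Orb \<Longrightarrow> h \<bullet> k \<in> Orb" "h \<in> Orb \<Longrightarrow> binv h \<in> Orb" "\<one>\<^bsub>BijGroup U\<^esub> \<in> Orb"
  using Aut_subgroup[OF is_structure_orbital]
  by (simp_all add: subgroup.m_closed subgroup.m_inv_closed subgroup.one_closed)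

lemma Orb_Bij: "h \<in> Orb \<Longrightarrow> h \<in> Bij U"
  using Orb_iff by blast

text \<open>The products are taken in \<open>BijGroup U\<close> because \<open>h\<close> need not
  lie in \<open>G\<close>. The restriction to \<open>G\<close> makes the map extensional, as
  membership in \<open>auto\<close> demands.\<close>

definition conj_by where
  "conj_by h = (\<lambda>g\<in>G. h \<bullet> g \<bullet> binv h)"

text \<open>Put \<open>ys\<close> = h^-1 \<open>xs\<close>. Since \<open>ys\<close> and
  \<open>g ys\<close> lie in one orbit and \<open>h\<close> preserves orbits of tuples, some
  automorphism sends \<open>xs\<close> = \<open>h ys\<close> to \<open>h (g ys)\<close>, which is
  the value of the conjugate at \<open>xs\<close>. So the conjugate agrees locally with
  automorphisms.\<close>

lemma conj_by_closed:
  assumes h: "h \<in> Orb" and g: "g \<in> G"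
  shows "conj_by h g \<in> G"
proof (rule Aut_mem_if_locally_Aut[OF str])
  show "conj_by h g \<in> Bij U"
    using h g by (simp add: conj_by_def Bij_simps Orb_Bij G_Bij)
  fix xs assume xs: "set xs \<subseteq> U"
  define ys where "ys = map (binv h) xs"
  have ys: "set ys \<subseteq> U" "set (map g ys) \<subseteq> U" "map h ys = xs"
    using xs h g unfolding ys_def map_map
    by (auto simp: subset_iff Bij_simps Orb_Bij G_Bij intro!: map_idI)
  then obtain k where k: "k \<in> G" "map k (map h ys) = map h (map g ys)"
    using h g Orb_iff[of h] by (metis length_map)
  have "map (conj_by h g) xs = map h (map g ys)"
    using xs h g by (auto simp: ys_def conj_by_def subset_iff Bij_simps Orb_Bij G_Bij)
  then show "\<exists>k\<in>G. map k xs = map (conj_by h g) xs"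
    using k ys(3) by metis
qed

lemma conj_by_apply:
  assumes "h \<in> Orb" "g \<in> G" "x \<in> U"
  shows "conj_by h g (h x) = h (g x)"
  using assms by (simp add: conj_by_def Bij_simps Orb_Bij G_Bij)

text \<open>As \<open>h\<close> is onto \<open>U\<close>, the conjugate is the only permutation
  \<open>k\<close> with k h = h g. This reduces identities between conjugates to evaluation at
  points \<open>h x\<close>.\<close>

lemma conj_by_eqI:
  assumes "h \<in> Orb" "g \<in> G" "k \<in> Bij U" "\<And>x. x \<in> U \<Longrightarrow> k (h x) = h (g x)"
  shows "conj_by h g = k"
proof (rule Bij_eqI)
  fix x assume "x \<in> U"
  then show "conj_by h g x = k x"
    using assms(4)[of "binv h x"] assms(1-3) by (simp add: conj_by_def Bij_simps Orb_Bij G_Bij)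
qed (use assms conj_by_closed G_Bij in auto)

lemma conj_by_hom:
  assumes h: "h \<in> Orb"
  shows "conj_by h \<in> hom (AutGrp L M) (AutGrp L M)"
proof (rule homI)
  fix g k assume gk: "g \<in> carrier (AutGrp L M)" "k \<in> carrier (AutGrp L M)"
  show "conj_by h (g \<otimes>\<^bsub>AutGrp L M\<^esub> k) = conj_by h g \<otimes>\<^bsub>AutGrp L M\<^esub> conj_by h k"
    using h gk by (intro conj_by_eqI)
      (simp_all add: conj_by_closed conj_by_apply Bij_simps Orb_Bij G_Bij)
qed (simp add: conj_by_closed[OF h])

lemma conj_by_mult:
  assumes "h \<in> Orb" "k \<in> Orb" "g \<in> G"
  shows "conj_by (h \<bullet> k) g = conj_by h (conj_by k g)"
proof (rule conj_by_eqI)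
  show "h \<bullet> k \<in> Orb" by (rule Orb_closed(1)[OF assms(1,2)])
qed (use assms in \<open>simp_all add: conj_by_closed conj_by_apply Bij_simps Orb_Bij G_Bij\<close>)

lemma conj_by_inverse:
  assumes h: "h \<in> Orb" and g: "g \<in> G"
  shows "conj_by h (conj_by (binv h) g) = g" "conj_by (binv h) (conj_by h g) = g"
proof -
  have i: "binv h \<in> Orb" by (rule Orb_closed(2)[OF h])
  have one: "conj_by \<one>\<^bsub>BijGroup U\<^esub> g = g"
    using g Orb_closed(3) by (intro conj_by_eqI) (simp_all add: Bij_simps G_Bij)
  show "conj_by h (conj_by (binv h) g) = g" "conj_by (binv h) (conj_by h g) = g"
    using one conj_by_mult[OF h i g] conj_by_mult[OF i h g] Orb_Bij[OF h] by simp_all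
qed

lemma conj_by_auto:
  assumes h: "h \<in> Orb"
  shows "conj_by h \<in> auto (AutGrp L M)"
proof -
  have i: "binv h \<in> Orb" by (rule Orb_closed(2)[OF h])
  have "bij_betw (conj_by h) G G"
    by (rule bij_betw_byWitness[where f' = "conj_by (binv h)"])
      (auto simp: conj_by_inverse[OF h] conj_by_closed[OF h] conj_by_closed[OF i])
  then show ?thesis
    using conj_by_hom[OF h] by (simp add: auto_def Bij_def) (simp add: conj_by_def)
qed

text \<open>Conjugation by \<open>h\<close> carries the stabilizer of h^-1(A) into that of
  \<open>A\<close>.\<close>

lemma conj_by_continuous:
  assumes h: "h \<in> Orb"
  shows "continuous_map (aut_topology L M) (aut_topology L M) (conj_by h)"
proof (rule hom_continuousI[OF conj_by_hom[OF h]])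
  fix A assume A: "finite A" "A \<subseteq> U"
  show "\<exists>B. finite B \<and> B \<subseteq> U \<and> conj_by h ` S B \<subseteq> S A"
  proof (intro exI conjI)
    show "finite (binv h ` A)" using A by simp
    show "binv h ` A \<subseteq> U" using A Orb_Bij[OF h] by (auto simp: Bij_simps)
    show "conj_by h ` S (binv h ` A) \<subseteq> S A"
    proof
      fix k assume "k \<in> conj_by h ` S (binv h ` A)"
      then obtain g where g: "g \<in> G" "\<forall>a\<in>A. g (binv h a) = binv h a" "k = conj_by h g"
        by (auto simp: pw_stab_def)
      have "k a = a" if "a \<in> A" for a
      proof -
        have "a \<in> U" using that A(2) by blast
        then show ?thesis
          using conj_by_apply[OF h g(1), of "binv h a"] g(2,3) that Orb_Bij[OF h]
          by (simp add: Bij_simps)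
      qed
      then show "k \<in> S A"
        using conj_by_closed[OF h g(1)] g(3) by (simp add: pw_stab_def)
    qed
  qed
qed

lemma conj_by_homeomorphic:
  assumes h: "h \<in> Orb"
  shows "homeomorphic_map (aut_topology L M) (aut_topology L M) (conj_by h)"
proof (rule homeomorphic_map_autoI[OF conj_by_auto[OF h] _ conj_by_continuous[OF h]])
  fix \<psi> assume \<psi>: "\<psi> \<in> auto (AutGrp L M)" "\<And>g. g \<in> G \<Longrightarrow> conj_by h (\<psi> g) = g"
  have i: "binv h \<in> Orb" by (rule Orb_closed(2)[OF h])
  have "conj_by (binv h) g = \<psi> g" if "g \<in> G" for g
    using conj_by_inverse(2)[OF h, of "\<psi> g"] \<psi>(2)[OF that] hom_closed[OF _ that, of \<psi>] \<psi>(1)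
    by (simp add: auto_def)
  then show "continuous_map (aut_topology L M) (aut_topology L M) \<psi>"
    using continuous_map_eq[OF conj_by_continuous[OF i]] by simp
qed

end

section \<open>Recovering points from the automorphism group\<close>

locale wei_no_algebraicity = structure_automorphisms L M for L :: "('f, 'r) language" and M :: "('a, 'f, 'r) fo_structure" +
  assumes wei: "weak_elim_imaginaries L M"
    and noalg: "no_algebraicity L M"
begin

lemma mem_if_finite_orbit:
  assumes "finite A" "A \<subseteq> U" "x \<in> U" "finite {g x | g. g \<in> S A}"
  shows "x \<in> A"
  using assms noalg by (auto simp: no_algebraicity_def alg_closed_def algebraic_over_def)

lemma mem_if_fixed:
  assumes "finite A" "A \<subseteq> U" "x \<in> U" "\<And>g. g \<in> S A \<Longrightarrow> g x = x"
  shows "x \<in> A"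
proof (rule mem_if_finite_orbit[OF assms(1-3)])
  have "{g x | g. g \<in> S A} \<subseteq> {x}" using assms(4) by auto
  then show "finite {g x | g. g \<in> S A}" by (rule finite_subset) simp
qed

text \<open>A point fixed by the stabilizer of \<open>x\<close> is algebraic over
  \<open>{x}\<close>, hence equals \<open>x\<close>. Points are thus determined by their
  stabilizers, and one inclusion suffices; identities between points are derived below from
  this.\<close>

lemma eq_if_point_stab_le:
  assumes "x \<in> U" "y \<in> U" "\<And>g. g \<in> G \<Longrightarrow> g x = x \<Longrightarrow> g y = y"
  shows "y = x"
  using mem_if_fixed[of "{x}" y] assms by (auto simp: pw_stab_def)

text \<open>A point fixed by all of \<open>G\<close> would be algebraic over the empty set.\<close>

lemma not_fixed:
  assumes "x \<in> U"
  obtains g where "g \<in> G" "g x \<noteq> x"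
  using mem_if_fixed[of "{}" x] assms by (auto simp: pw_stab_def)

lemma open_subgroup_support:
  assumes "subgroup H (AutGrp L M)" "openin (aut_topology L M) H"
  obtains K where "finite K" "K \<subseteq> U" "S K \<subseteq> H" "\<And>g. g \<in> H \<Longrightarrow> g ` K = K"
proof -
  obtain K where "wei_support L M H K"
    using wei assms open_subgroup_contains_pw_stab[OF assms(2,1)]
    unfolding weak_elim_imaginaries_def by blast
  then have "finite K" "K \<subseteq> U" "S K \<subseteq> H" "H \<subseteq> {g \<in> G. g ` K = K}"
    by (simp_all add: wei_support_def set_stab_def)
  then show thesis
    by (intro that[of K]) (simp, simp, simp, blast)
qed

text \<open>An element \<open>u\<close> fixing \<open>h x\<close> is the conjugate by
  \<open>h\<close> of some \<open>g\<close> fixing \<open>x\<close>. As it is also the conjugate of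
  \<open>g\<close> by \<open>k\<close>, it fixes \<open>k x\<close>. So \<open>k x\<close> is fixed
  by the stabilizer of \<open>h x\<close>.\<close>

lemma conj_by_inj:
  assumes hk: "h \<in> Orb" "k \<in> Orb" and eq: "conj_by h = conj_by k"
  shows "h = k"
proof (rule Bij_eqI)
  fix x assume x: "x \<in> U"
  have i: "binv h \<in> Orb" by (rule Orb_closed(2)[OF hk(1)])
  have "k x = h x"
  proof (rule eq_if_point_stab_le)
    fix u assume u: "u \<in> G" "u (h x) = h x"
    let ?g = "conj_by (binv h) u"
    have g: "?g \<in> G" by (rule conj_by_closed[OF i u(1)])
    have "h (?g x) = h x"
      using conj_by_apply[OF hk(1) g x] conj_by_inverse(1)[OF hk(1) u(1)] u(2) by simp
    then have "?g x = x"
      using Bij_apply_eq_iff[OF Orb_Bij[OF hk(1)]] g x by simp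
    then show "u (k x) = k x"
      using conj_by_apply[OF hk(2) g x] conj_by_inverse(1)[OF hk(1) u(1)] eq by simp
  qed (use x hk in \<open>simp_all add: Orb_Bij Bij_simps\<close>)
  then show "h x = k x" by simp
qed (use hk Orb_Bij in auto)

end

section \<open>Topological automorphisms are conjugations\<close>

locale topological_automorphism = wei_no_algebraicity L M for L :: "('f, 'r) language" and M :: "('a, 'f, 'r) fo_structure" +
  fixes \<phi> \<psi> :: "('a \<Rightarrow> 'a) \<Rightarrow> ('a \<Rightarrow> 'a)"
  assumes \<phi>: "\<phi> \<in> hom (AutGrp L M) (AutGrp L M)"
    and \<psi>: "\<psi> \<in> hom (AutGrp L M) (AutGrp L M)"
    and \<psi>\<phi>: "g \<in> Aut L M \<Longrightarrow> \<psi> (\<phi> g) = g"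
    and \<phi>\<psi>: "g \<in> Aut L M \<Longrightarrow> \<phi> (\<psi> g) = g"
    and \<phi>_cont: "continuous_map (aut_topology L M) (aut_topology L M) \<phi>"
    and \<psi>_cont: "continuous_map (aut_topology L M) (aut_topology L M) \<psi>"
begin

text \<open>The assumptions are symmetric in \<phi> and \<psi>; this makes every result of the
  locale available for the inverse as well.\<close>

lemma inverse_automorphism: "topological_automorphism L M \<psi> \<phi>"
  by unfold_locales (rule \<phi> \<psi> \<phi>\<psi> \<psi>\<phi> \<phi>_cont \<psi>_cont; assumption?)+

lemmas \<phi>_closed [simp] = hom_closed[OF \<phi>] and \<psi>_closed [simp] = hom_closed[OF \<psi>]

text \<open>If \<open>K\<close> supports \<open>\<phi> (S C)\<close> and \<open>D\<close> supports the preimage of \<open>S K\<close>, then this preimage has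
  finite index in \<open>S C\<close>: the translate of \<open>D\<close> under \<open>g \<in> S C\<close> is determined by the permutation that
  \<open>\<phi> g\<close> induces on \<open>K\<close>. So \<open>D\<close> is algebraic over \<open>C\<close>, hence contained in \<open>C\<close>.\<close>

lemma pw_stab_image:
  assumes C: "finite C" "C \<subseteq> U"
  obtains K where "finite K" "K \<subseteq> U" "\<And>g. g \<in> G \<Longrightarrow> \<phi> g \<in> S K \<longleftrightarrow> g \<in> S C"
proof -
  have "openin (aut_topology L M) {g \<in> G. \<psi> g \<in> S C}"
    using openin_continuous_map_preimage[OF \<psi>_cont pw_stab_open[OF C]] by simp
  \<comment> \<open>The image of \<open>S C\<close> under \<phi> is written as a preimage under
    \<psi>, so that continuity of \<psi> shows that it is open.\<close>
  then obtain K where K: "finite K" "K \<subseteq> U" "S K \<subseteq> {g \<in> G. \<psi> g \<in> S C}"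
      "\<And>g. g \<in> {g \<in> G. \<psi> g \<in> S C} \<Longrightarrow> g ` K = K"
    using open_subgroup_support[OF pw_stab_preimage_subgroup[OF \<psi> C(2)]] by blast
  let ?P = "{g \<in> G. \<phi> g \<in> S K}"
  have "openin (aut_topology L M) ?P"
    using openin_continuous_map_preimage[OF \<phi>_cont pw_stab_open[OF K(1,2)]] by simp
  then obtain D where D: "finite D" "D \<subseteq> U" "S D \<subseteq> ?P" "\<And>g. g \<in> ?P \<Longrightarrow> g ` D = D"
    using open_subgroup_support[OF pw_stab_preimage_subgroup[OF \<phi> K(2)]] by blast
  have SG: "g \<in> G" if "g \<in> S C" for g using that by (simp add: pw_stab_def)
  define t where "t g = restrict (\<phi> g) K" for g
  have "t g \<in> K \<rightarrow>\<^sub>E K" if "g \<in> S C" for g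
  proof -
    have "\<phi> g ` K = K" using K(4)[of "\<phi> g"] that SG[OF that] \<psi>\<phi> by simp
    then show ?thesis by (auto simp: t_def)
  qed
  then have fin: "finite (t ` S C)"
    by (intro finite_subset[OF _ finite_PiE[OF K(1), of "\<lambda>_. K"]]) (use K(1) in auto)
  have "g ` D = k ` D" if gk: "g \<in> S C" "k \<in> S C" "t g = t k" for g k
  proof -
    have G: "g \<in> G" "k \<in> G" using gk SG by auto
    have eq: "\<phi> g a = \<phi> k a" if "a \<in> K" for a
      using fun_cong[OF gk(3), of a] that by (simp add: t_def)
    \<comment> \<open>Since \<phi> g and \<phi> k agree on \<open>K\<close>, the image of k^-1 g
      fixes \<open>K\<close> pointwise. Hence k^-1 g preserves \<open>D\<close> setwise.\<close>
    have "binv k \<bullet> g \<in> ?P"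
      using G K(2) by (auto simp: hom_mult[OF \<phi>] hom_inv[OF \<phi>] pw_stab_def eq subset_iff)
    then have "(binv k \<bullet> g) ` D = D" by (rule D(4))
    then have "k ` D = k ` (binv k \<bullet> g) ` D" by simp
    also have "\<dots> = g ` D"
      unfolding image_image using D(2) G by (intro image_cong) (auto simp: subset_iff)
    finally show ?thesis by simp
  qed
  then obtain f where "(\<lambda>g. g ` D) ` S C = f ` (t ` S C)"
    using factors_through[of "S C" t "\<lambda>g. g ` D"] by blast
  then have "finite ((\<lambda>g. g ` D) ` S C)" using fin by simp
  \<comment> \<open>Finitely many finite translates of \<open>D\<close> cover the
    \<open>S C\<close>-orbits of all points of \<open>D\<close>.\<close>
  then have "finite (\<Union>((\<lambda>g. g ` D) ` S C))" using D(1) by auto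
  then have "finite {g x | g. g \<in> S C}" if "x \<in> D" for x
    by (rule rev_finite_subset) (use that in auto)
  then have "D \<subseteq> C"
    using mem_if_finite_orbit[OF C] D(2) by blast
  then have "S C \<subseteq> ?P" using D(3) by (auto simp: pw_stab_def)
  moreover have "g \<in> S C" if "g \<in> G" "\<phi> g \<in> S K" for g
    using that K(3) \<psi>\<phi> by fastforce
  ultimately show thesis using K(1,2) that by blast
qed

text \<open>Point stabilizers are maximal among the proper stabilizers of finite sets. The image of
  \<open>S {a}\<close> is some \<open>S K\<close> with \<open>K\<close> nonempty; for
  \<open>b\<close> in \<open>K\<close>, the stabilizer of \<open>b\<close> pulls back to some
  \<open>S D\<close> containing \<open>S {a}\<close>. So \<open>D\<close> is contained in
  \<open>{a}\<close>, and it is nonempty because \<open>b\<close> is moved by some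
  automorphism.\<close>

lemma point_stab_image:
  assumes a: "a \<in> U"
  shows "\<exists>b\<in>U. \<forall>g\<in>G. \<phi> g b = b \<longleftrightarrow> g a = a"
proof -
  interpret inv: topological_automorphism L M \<psi> \<phi> by (rule inverse_automorphism)
  obtain K where K: "finite K" "K \<subseteq> U" "\<And>g. g \<in> G \<Longrightarrow> \<phi> g \<in> S K \<longleftrightarrow> g \<in> S {a}"
    using pw_stab_image[of "{a}"] a by auto
  have "K \<noteq> {}"
  proof
    assume "K = {}"
    obtain g where "g \<in> G" "g a \<noteq> a" using not_fixed[OF a] .
    then show False using K(3)[of g] \<open>K = {}\<close> by (simp add: pw_stab_def)
  qed
  then obtain b where b: "b \<in> K" "b \<in> U" using K(2) by blast
  obtain D where D: "finite D" "D \<subseteq> U" "\<And>g. g \<in> G \<Longrightarrow> \<psi> g \<in> S D \<longleftrightarrow> g \<in> S {b}"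
    using inv.pw_stab_image[of "{b}"] b by auto
  have D': "g \<in> S D \<longleftrightarrow> \<phi> g b = b" if "g \<in> G" for g
    using D(3)[of "\<phi> g"] that \<psi>\<phi> by (simp add: pw_stab_def)
  have "D \<subseteq> {a}"
  proof
    fix d assume d: "d \<in> D"
    have "g d = d" if "g \<in> S {a}" for g
    proof -
      have "g \<in> G" using that by (simp add: pw_stab_def)
      then have "\<phi> g b = b" using K(3) that b(1) by (auto simp: pw_stab_def)
      then show ?thesis using D' \<open>g \<in> G\<close> d by (auto simp: pw_stab_def)
    qed
    then show "d \<in> {a}"
      using mem_if_fixed[of "{a}" d] a d D(2) by auto
  qed
  moreover have "D \<noteq> {}"
  proof
    assume "D = {}"
    obtain g where "g \<in> G" "g b \<noteq> b" using not_fixed[OF b(2)] .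
    then show False using D(3)[of g] \<open>D = {}\<close> by (simp add: pw_stab_def)
  qed
  ultimately have "D = {a}" by blast
  then show ?thesis
    using D' b(2) by (auto simp: pw_stab_def)
qed

lemma is_conjugation: "\<exists>h\<in>Orb. \<forall>g\<in>G. conj_by h g = \<phi> g"
proof -
  interpret inv: topological_automorphism L M \<psi> \<phi> by (rule inverse_automorphism)
  obtain h' where h': "\<And>a. a \<in> U \<Longrightarrow> h' a \<in> U \<and> (\<forall>g\<in>G. \<phi> g (h' a) = h' a \<longleftrightarrow> g a = a)"
    using point_stab_image by metis
  obtain k where k: "\<And>a. a \<in> U \<Longrightarrow> k a \<in> U \<and> (\<forall>g\<in>G. \<psi> g (k a) = k a \<longleftrightarrow> g a = a)"
    using inv.point_stab_image by metis
  \<comment> \<open>Elements of \<open>Bij U\<close> must be \<open>undefined\<close> outside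
    \<open>U\<close>.\<close>
  define h where "h = restrict h' U"
  have h: "h a \<in> U" "g \<in> G \<Longrightarrow> \<phi> g (h a) = h a \<longleftrightarrow> g a = a" if "a \<in> U" for a g
    using h'[OF that] that by (simp_all add: h_def)
  \<comment> \<open>Transporting the stabilizer of \<open>b\<close> along \<psi> and back along
    \<phi> shows that it fixes \<open>h (k b)\<close>.\<close>
  have hk: "h (k b) = b" if "b \<in> U" for b
  proof (rule eq_if_point_stab_le)
    fix g assume g: "g \<in> G" "g b = b"
    then have "\<psi> g (k b) = k b" using k[OF that] by blast
    then have "\<phi> (\<psi> g) (h (k b)) = h (k b)" using h(2) k[OF that] g(1) by simp
    then show "g (h (k b)) = h (k b)" using \<phi>\<psi>[OF g(1)] by simp
  qed (use that h k in auto)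
  have kh: "k (h a) = a" if "a \<in> U" for a
  proof (rule eq_if_point_stab_le)
    fix g assume g: "g \<in> G" "g a = a"
    then have "\<phi> g (h a) = h a" using h(2)[OF that] by blast
    then have "\<psi> (\<phi> g) (k (h a)) = k (h a)" using h(1)[OF that] k g(1) by simp
    then show "g (k (h a)) = k (h a)" using \<psi>\<phi>[OF g(1)] by simp
  qed (use that h k in auto)
  have "bij_betw h U U"
    by (rule bij_betw_byWitness[where f' = k]) (use h k hk kh in auto)
  then have hB: "h \<in> Bij U" by (simp add: Bij_def h_def)
  \<comment> \<open>If \<open>u\<close> fixes \<open>h (g a)\<close>, then \<psi> u fixes
    \<open>g a\<close>, so its conjugate by g^-1 fixes \<open>a\<close>. Applying \<phi>, the
    conjugate of \<open>u\<close> by the inverse of \<phi> g fixes \<open>h a\<close>, so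
    \<open>u\<close> fixes \<phi> g (h a).\<close>
  have equiv: "\<phi> g (h a) = h (g a)" if g: "g \<in> G" and a: "a \<in> U" for g a
  proof (rule eq_if_point_stab_le)
    fix u assume u: "u \<in> G" "u (h (g a)) = h (g a)"
    then have "\<phi> (\<psi> u) (h (g a)) = h (g a)" using \<phi>\<psi> by simp
    then have "\<psi> u (g a) = g a" using h(2)[of "g a" "\<psi> u"] g a u by simp
    then have "(binv g \<bullet> (\<psi> u \<bullet> g)) a = a" using g a u by simp
    then have "\<phi> (binv g \<bullet> (\<psi> u \<bullet> g)) (h a) = h a" using h(2)[OF a] g u by simp
    moreover have "\<phi> (binv g \<bullet> (\<psi> u \<bullet> g)) = binv (\<phi> g) \<bullet> (u \<bullet> \<phi> g)"
      using g u by (simp add: hom_mult[OF \<phi>] hom_inv[OF \<phi>] \<phi>\<psi>)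
    ultimately have "binv (\<phi> g) (u (\<phi> g (h a))) = h a" using g u h(1)[OF a] by simp
    then have "\<phi> g (binv (\<phi> g) (u (\<phi> g (h a)))) = \<phi> g (h a)" by simp
    then show "u (\<phi> g (h a)) = \<phi> g (h a)" using g u h(1)[OF a] by simp
  qed (use g a h in simp_all)
  have "h \<in> Orb"
    unfolding Orb_iff
  proof (intro conjI allI impI)
    fix xs ys assume xy: "length xs = length ys" "set xs \<subseteq> U" "set ys \<subseteq> U"
    \<comment> \<open>By equivariance, \<phi> and \<psi> turn witnesses for the orbit relation on
      \<open>xs\<close>, \<open>ys\<close> into witnesses on their images under \<open>h\<close>,
      and back.\<close>
    have eq: "map (\<phi> g) (map h xs) = map h (map g xs)" if "g \<in> G" for g
      using xy equiv that by (auto simp: subset_iff)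
    have inj: "map g xs = ys" if "g \<in> G" "map h (map g xs) = map h ys" for g
    proof -
      have "map k (map h zs) = zs" if "set zs \<subseteq> U" for zs
        unfolding map_map using that kh by (intro map_idI) auto
      moreover have "set (map g xs) \<subseteq> U" using that xy by auto
      ultimately show ?thesis using that(2) xy(3) by metis
    qed
    show "(\<exists>g\<in>G. map g xs = ys) \<longleftrightarrow> (\<exists>g\<in>G. map g (map h xs) = map h ys)"
    proof
      assume "\<exists>g\<in>G. map g xs = ys"
      then obtain g where "g \<in> G" "map g xs = ys" by blast
      then show "\<exists>g\<in>G. map g (map h xs) = map h ys"
        using eq[of g] by (intro bexI[of _ "\<phi> g"]) simp_all
    next
      assume "\<exists>g\<in>G. map g (map h xs) = map h ys"
      then obtain g where g: "g \<in> G" "map g (map h xs) = map h ys" by blast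
      then have "map h (map (\<psi> g) xs) = map h ys"
        using eq[of "\<psi> g"] \<phi>\<psi> by simp
      then show "\<exists>g\<in>G. map g xs = ys" using inj[of "\<psi> g"] g(1) by auto
    qed
  qed (rule hB)
  moreover have "conj_by h g = \<phi> g" if "g \<in> G" for g
    using that equiv \<open>h \<in> Orb\<close> by (intro conj_by_eqI) (simp_all add: G_Bij)
  ultimately show ?thesis by blast
qed

end

section \<open>The isomorphism of groups\<close>

context wei_no_algebraicity
begin

lemma homeomorphic_auto_is_conjugation:
  assumes \<phi>: "\<phi> \<in> auto (AutGrp L M)"
    and homeo: "homeomorphic_map (aut_topology L M) (aut_topology L M) \<phi>"
  shows "\<phi> \<in> conj_by ` Orb"
proof -
  obtain \<psi> where \<psi>: "\<psi> \<in> auto (AutGrp L M)"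
    "\<And>g. g \<in> G \<Longrightarrow> \<psi> (\<phi> g) = g" "\<And>g. g \<in> G \<Longrightarrow> \<phi> (\<psi> g) = g"
    using auto_inverse[OF \<phi>] by blast
  obtain \<psi>' where \<psi>': "homeomorphic_maps (aut_topology L M) (aut_topology L M) \<phi> \<psi>'"
    using homeo homeomorphic_map_maps by blast
  \<comment> \<open>The algebraic inverse \<psi> is a homomorphism and the topological inverse
    \<open>\<psi>'\<close> is continuous; as they agree on \<open>G\<close>, \<psi> has both
    properties.\<close>
  have "\<psi>' g = \<psi> g" if "g \<in> G" for g
  proof -
    have "\<psi> g \<in> G" using \<psi>(1) that hom_closed by (simp add: auto_def)
    then have "\<psi>' (\<phi> (\<psi> g)) = \<psi> g" using \<psi>' by (simp add: homeomorphic_maps_def)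
    then show ?thesis using \<psi>(3)[OF that] by simp
  qed
  then have "continuous_map (aut_topology L M) (aut_topology L M) \<psi>"
    using \<psi>' continuous_map_eq by (fastforce simp: homeomorphic_maps_def)
  then interpret topological_automorphism L M \<phi> \<psi>
    using \<psi> \<phi> homeomorphic_imp_continuous_map[OF homeo]
    by unfold_locales (auto simp: auto_def)
  obtain h where h: "h \<in> Orb" "\<forall>g\<in>G. conj_by h g = \<phi> g"
    using is_conjugation by blast
  \<comment> \<open>Agreement on \<open>G\<close> gives equality of functions because both are
    extensional.\<close>
  then have "conj_by h = \<phi>"
    using assms(1) by (intro extensionalityI[of _ G])
      (auto simp: conj_by_def auto_def Bij_def)
  then show ?thesis using h(1) by blast
qed

text \<open>The isomorphism \<open>conj_by\<close> starts at the automorphism group of the orbital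
  structure, so the relation is reversed first.\<close>

lemma TopAutoGroup_iso:
  "TopAutoGroup (AutGrp L M) (aut_topology L M)
     \<cong> AutGrp orbital_language (orbital_structure L M)"
proof (rule group.iso_sym[OF group_AutGrp[OF is_structure_orbital]], rule is_isoI)
  let ?T = "TopAutoGroup (AutGrp L M) (aut_topology L M)"
  have carrier: "carrier ?T = conj_by ` Orb"
    using homeomorphic_auto_is_conjugation conj_by_auto conj_by_homeomorphic
    by (auto simp: TopAutoGroup_def)
  have mult: "mult ?T = mult (BijGroup G)"
    by (simp add: TopAutoGroup_def AutoGroup_def)
  have "conj_by (h \<bullet> k) = conj_by h \<otimes>\<^bsub>BijGroup G\<^esub> conj_by k" if hk: "h \<in> Orb" "k \<in> Orb" for h k
  proof -
    have "conj_by h \<in> Bij G" "conj_by k \<in> Bij G"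
      using conj_by_auto hk by (auto simp: auto_def)
    moreover have "conj_by (h \<bullet> k) = compose G (conj_by h) (conj_by k)"
    proof (rule extensionalityI)
      show "conj_by (h \<bullet> k) \<in> extensional G" by (simp add: conj_by_def)
    qed (simp_all add: compose_eq conj_by_mult[OF hk])
    ultimately show ?thesis by (simp add: BijGroup_mult_eq_compose)
  qed
  then show "conj_by \<in> iso (AutGrp orbital_language (orbital_structure L M)) ?T"
    using conj_by_inj unfolding iso_def
    by (auto intro!: homI simp: carrier mult bij_betw_def inj_on_def)
qed

text \<open>An automorphism and its inverse are both homomorphisms, hence both continuous under the
  small index property.\<close>

lemma small_index_AutoGroup_eq:
  assumes "small_index_property L M" "countable U"
  shows "TopAutoGroup (AutGrp L M) (aut_topology L M) = AutoGroup (AutGrp L M)"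
proof -
  have "continuous_map (aut_topology L M) (aut_topology L M) \<phi>" if "\<phi> \<in> auto (AutGrp L M)" for \<phi>
    using small_index_hom_continuous[OF assms] that by (simp add: auto_def)
  then have "{\<phi> \<in> auto (AutGrp L M). homeomorphic_map (aut_topology L M) (aut_topology L M) \<phi>}
      = auto (AutGrp L M)"
    using homeomorphic_map_autoI by blast
  then show ?thesis
    by (simp add: TopAutoGroup_def AutoGroup_def)
qed

end

theorem theorem1p4:
  fixes L :: "('f, 'r) language" and M :: "('a, 'f, 'r) fo_structure"
  assumes "is_structure L M"
    and "countable (univ M)"
    and "omega_categorical L M"
    and "homogeneous L M"
    and "weak_elim_imaginaries L M"
    and "no_algebraicity L M"
  shows "TopAutoGroup (AutGrp L M) (aut_topology L M)
           \<cong> AutGrp orbital_language (orbital_structure L M) \<and>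
         (small_index_property L M \<longrightarrow>
           AutoGroup (AutGrp L M) \<cong> AutGrp orbital_language (orbital_structure L M))"
proof -
  interpret wei_no_algebraicity L M
    using assms by unfold_locales
  show ?thesis
    using TopAutoGroup_iso small_index_AutoGroup_eq[OF _ assms(2)] by metis
qed

end
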